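(* Let $G$ be a 2-connected graph of order divisible by $4$. Then $G^4$ contains a $K_4$-factor.
   Context: Graphs are finite, and the order of a graph is its number of vertices. For a graph $G$ and $k \ge 1$, the $k$th power $G^k$ is the graph with the same vertex set as $G$ in which two distinct vertices are adjacent if and only if there is a path between them in $G$ of length at most $k$. A $K_r$-factor in a graph is a spanning subgraph in which every connected component is isomorphic to the complete graph $K_r$ on $r$ vertices. *)

theory Defs
  imports "Graph_Theory.Graph_Theory"
begin

text \<open>
  Finite simple graphs are \<^locale>\<open>pair_graph\<close>: finite, loop-free digraphs with a symmetric
  arc relation, each undirected edge \<open>{u,v}\<close> being represented by the two arcs \<open>(u,v)\<close>
  and \<open>(v,u)\<close>.
\<close>

text \<open>
  An \<open>apath\<close> is given by its list of arcs, so \<open>length p\<close> is the number of edges of the path.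
  The path may pass through any vertices of the graph.
\<close>
definition graph_power :: "'a pair_pre_digraph \<Rightarrow> nat \<Rightarrow> 'a pair_pre_digraph" where
  "graph_power G k = \<lparr> pverts = pverts G,
     parcs = {(u, v). u \<in> pverts G \<and> v \<in> pverts G \<and> u \<noteq> v \<and>
       (\<exists>p. pre_digraph.apath (with_proj G) u p v \<and> length p \<le> k)} \<rparr>"

text \<open>
  The convention is the usual one: more than \<open>k\<close> vertices, and deleting fewer than \<open>k\<close> of them
  leaves a connected graph. In particular a 2-connected graph has at least three vertices.
\<close>
definition k_connected :: "nat \<Rightarrow> ('a, 'b) pre_digraph \<Rightarrow> bool" where
  "k_connected k G \<longleftrightarrow> k < card (verts G) \<and>
     (\<forall>X \<subseteq> verts G. card X < k \<longrightarrow> connected (G \<restriction> (verts G - X)))"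

text \<open>
  As \<open>H\<close> is symmetric, its strongly connected components (\<open>sccs\<close>) are its connected components.
  The predicate \<open>K\<^bsub>r\<^esub>\<close> holds for the complete graphs on \<open>r\<close> vertices, whatever their vertices
  are, so it already expresses being isomorphic to the complete graph on \<open>r\<close> vertices.
\<close>
definition complete_factor :: "nat \<Rightarrow> 'a pair_pre_digraph \<Rightarrow> 'a pair_pre_digraph \<Rightarrow> bool" where
  "complete_factor r H G \<longleftrightarrow> pair_graph H \<and> spanning (with_proj H) (with_proj G) \<and>
     (\<forall>C \<in> pre_digraph.sccs (with_proj H). K\<^bsub>r\<^esub> C)"

lemma pair_graph_graph_power:
  assumes "pair_graph G"
  shows "pair_graph (graph_power G k)"
proof -
  interpret pair_graph G by fact
  have "finite (parcs (graph_power G k))"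
    by (rule finite_subset[of _ "pverts G \<times> pverts G"]) (auto simp: graph_power_def)
  moreover have "sym (parcs (graph_power G k))"
  proof (rule symI)
    fix u v assume "(u, v) \<in> parcs (graph_power G k)"
    then obtain p where "u \<in> pverts G" "v \<in> pverts G" "u \<noteq> v" "apath u p v" "length p \<le> k"
      by (auto simp: graph_power_def)
    moreover have "length (rev_path p) = length p" by (induct p) auto
    ultimately have "apath v (rev_path p) u" "length (rev_path p) \<le> k"
      by (auto simp: apath_rev_path)
    with \<open>u \<in> pverts G\<close> \<open>v \<in> pverts G\<close> \<open>u \<noteq> v\<close> show "(v, u) \<in> parcs (graph_power G k)"
      by (auto simp: graph_power_def simp del: apath_rev_path)
  qed
  ultimately show ?thesis
    by unfold_locales (auto simp: graph_power_def symmetric_def)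
qed

end

theory Submission
  imports Defs
begin

text \<open>
  A connected graph of even order has a spanning forest in which all degrees are odd. Root each of
  its trees and let \<open>b\<close> send a vertex to its parent and a root to itself; then every fibre of
  \<open>b\<close>, the bag of a vertex \<open>w\<close>, is an even subset of the closed neighbourhood of \<open>w\<close>, so it splits
  into pairs. Moving a root along its tree moves one of these pairs and changes nothing else, hence
  each tree offers one pair that may sit at any of its vertices, besides \<open>(deg w - 1) / 2\<close> pairs
  fixed at each vertex \<open>w\<close>. Two pairs sitting at vertices with a common closed neighbour \<open>x\<close> form
  four vertices within distance 2 of \<open>x\<close>, that is, a \<open>K\<^sub>4\<close> of the fourth power. It remains to match
  the pairs perfectly, which is a question for Tutte's theorem: a minimal barrier \<open>S\<close> would separate
  the other pairs into more than \<open>card S\<close> classes with disjoint territories, and since by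
  2-connectedness a class needs two boundary vertices of its own, counting the vertices of the trees
  whose movable pair lies in \<open>S\<close> shows that there are at most \<open>card S\<close> classes.
\<close>

section \<open>Matchings\<close>

lemma ex_arg_max_finite:
  fixes f :: "'a \<Rightarrow> nat"
  assumes "finite A" "A \<noteq> {}"
  shows "\<exists>x\<in>A. \<forall>y\<in>A. f y \<le> f x"
proof -
  have "Max (f ` A) \<in> f ` A" using assms by simp
  then obtain x where "x \<in> A" "f x = Max (f ` A)" by force
  then show ?thesis using assms by (intro bexI[of _ x]) simp_all
qed

definition matching :: "'a set \<Rightarrow> ('a \<Rightarrow> 'a \<Rightarrow> bool) \<Rightarrow> 'a set set \<Rightarrow> bool" where
  "matching V R M \<longleftrightarrow>
     (\<forall>e\<in>M. \<exists>u v. e = {u, v} \<and> u \<in> V \<and> v \<in> V \<and> u \<noteq> v \<and> R u v) \<and> pairwise disjnt M"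

definition maximum_matching :: "'a set \<Rightarrow> ('a \<Rightarrow> 'a \<Rightarrow> bool) \<Rightarrow> 'a set set \<Rightarrow> bool" where
  "maximum_matching V R M \<longleftrightarrow> matching V R M \<and> (\<forall>N. matching V R N \<longrightarrow> card N \<le> card M)"

lemma matching_subset_Pow: "matching V R M \<Longrightarrow> M \<subseteq> Pow V"
  by (fastforce simp: matching_def)

lemma finite_matching: "finite V \<Longrightarrow> matching V R M \<Longrightarrow> finite M"
  by (rule finite_subset[OF matching_subset_Pow]) simp_all

lemma matching_disjoint: "matching V R M \<Longrightarrow> e \<in> M \<Longrightarrow> f \<in> M \<Longrightarrow> e \<noteq> f \<Longrightarrow> e \<inter> f = {}"
  unfolding matching_def pairwise_def disjnt_def by blast

lemma matching_mono:
  assumes "matching V R M" "V \<subseteq> W"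
  shows "matching W R M"
  unfolding matching_def
proof (intro conjI ballI)
  fix e assume "e \<in> M"
  then obtain u v where "e = {u, v}" "u \<in> V" "v \<in> V" "u \<noteq> v" "R u v"
    using assms(1) by (auto simp: matching_def)
  then show "\<exists>u v. e = {u, v} \<and> u \<in> W \<and> v \<in> W \<and> u \<noteq> v \<and> R u v"
    using assms(2) by (intro exI[of _ u] exI[of _ v]) auto
qed (use assms(1) in \<open>simp add: matching_def\<close>)

lemma card_Union_matching:
  assumes "finite V" "matching V R M"
  shows "card (\<Union>M) = 2 * card M"
proof -
  have "card (\<Union>M) = (\<Sum>e\<in>M. card e)"
    using assms(2) by (intro card_Union_disjoint) (auto simp: matching_def)
  also have "\<dots> = (\<Sum>e\<in>M. 2)"
    using assms(2) by (intro sum.cong) (auto simp: matching_def)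
  finally show ?thesis by simp
qed

lemma ex_maximum_matching:
  assumes "finite V"
  shows "\<exists>M. maximum_matching V R M"
proof -
  have "{M. matching V R M} \<subseteq> Pow (Pow V)" using matching_subset_Pow by blast
  then have "finite {M. matching V R M}" by (rule finite_subset) (simp add: assms)
  moreover have "matching V R {}"
    by (simp add: matching_def pairwise_def disjnt_def)
  then have "{M. matching V R M} \<noteq> {}" by blast
  ultimately show ?thesis
    using ex_arg_max_finite[of "{M. matching V R M}" card] unfolding maximum_matching_def by blast
qed

lemma matching_insert:
  assumes "matching V R N" "u \<in> V" "v \<in> V" "u \<noteq> v" "R u v" "u \<notin> \<Union>N" "v \<notin> \<Union>N"
  shows "matching V R (insert {u, v} N)"
proof -
  have "\<forall>e\<in>insert {u, v} N. \<exists>u v. e = {u, v} \<and> u \<in> V \<and> v \<in> V \<and> u \<noteq> v \<and> R u v"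
    using assms(1-5) by (auto simp: matching_def)
  moreover have "pairwise disjnt (insert {u, v} N)"
    using assms(1,6,7) by (auto simp: matching_def pairwise_insert disjnt_def)
  ultimately show ?thesis by (simp add: matching_def)
qed

lemma matching_subset: "matching V R N \<Longrightarrow> M \<subseteq> N \<Longrightarrow> matching V R M"
  by (auto simp: matching_def intro: pairwise_mono)

text \<open>
  Gallai's lemma: being equal or not missed by a common maximum matching is a transitive relation.
\<close>

lemma missed_by_maximum_matching_trans:
  assumes fin: "finite V" and sym: "\<And>x y. R x y \<Longrightarrow> R y x"
    and t: "\<exists>N. maximum_matching V R N \<and> t \<notin> \<Union>N"
    and ut: "u \<noteq> t" "\<And>N. maximum_matching V R N \<Longrightarrow> u \<notin> \<Union>N \<Longrightarrow> t \<in> \<Union>N"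
    and vt: "v \<noteq> t" "\<And>N. maximum_matching V R N \<Longrightarrow> v \<notin> \<Union>N \<Longrightarrow> t \<in> \<Union>N"
    and uv: "u \<noteq> v"
    and M: "maximum_matching V R M" "u \<notin> \<Union>M"
  shows "v \<in> \<Union>M"
proof (rule ccontr)
  assume vM: "v \<notin> \<Union>M"
  define \<N> where "\<N> = {N. maximum_matching V R N \<and> t \<notin> \<Union>N}"
  have "\<N> \<subseteq> Pow (Pow V)"
    using matching_subset_Pow unfolding \<N>_def maximum_matching_def by blast
  then have "finite \<N>" by (rule finite_subset) (simp add: fin)
  moreover have "\<N> \<noteq> {}" using t by (auto simp: \<N>_def)
  ultimately obtain N where N: "N \<in> \<N>" and N_max: "\<And>N'. N' \<in> \<N> \<Longrightarrow> card (M \<inter> N') \<le> card (M \<inter> N)"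
    using ex_arg_max_finite[of \<N> "\<lambda>N. card (M \<inter> N)"] by blast
  have mN: "matching V R N" and mM: "matching V R M" and maxN: "maximum_matching V R N"
    and tN: "t \<notin> \<Union>N"
    using N M by (auto simp: \<N>_def maximum_matching_def)
  have "\<Union>M \<subseteq> V" "\<Union>N \<subseteq> V"
    using matching_subset_Pow[OF mM] matching_subset_Pow[OF mN] by blast+
  then have finMN: "finite M" "finite N" "finite (\<Union>M)" "finite (\<Union>N)"
    using finite_matching[OF fin mM] finite_matching[OF fin mN] finite_subset[OF _ fin] by simp_all
  have cMN: "card M = card N"
    using M(1) maxN by (auto simp: maximum_matching_def intro: antisym)
  have uN: "u \<in> \<Union>N" and vN: "v \<in> \<Union>N"
    using ut(2)[OF maxN] vt(2)[OF maxN] tN by blast+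
  have "card (\<Union>M) = card (\<Union>N)"
    using card_Union_matching[OF fin mM] card_Union_matching[OF fin mN] cMN by simp
  then have "card (\<Union>M - \<Union>N) = card (\<Union>N - \<Union>M)"
    using finMN by (simp add: card_Diff_subset_Int Int_commute)
  moreover have "card {u, v} \<le> card (\<Union>N - \<Union>M)"
    using uN vN M(2) vM finMN by (intro card_mono) auto
  ultimately have "2 \<le> card (\<Union>M - \<Union>N)" using uv by simp
  then have "\<not> \<Union>M - \<Union>N \<subseteq> {t}"
    using card_mono[of "{t}" "\<Union>M - \<Union>N"] by auto
  then obtain x where x: "x \<in> \<Union>M" "x \<notin> \<Union>N" "x \<noteq> t" by blast
  then obtain e where e: "e \<in> M" "x \<in> e" by blast
  then obtain y where y: "e = {x, y}" "x \<in> V" "y \<in> V" "x \<noteq> y" "R x y"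
    using mM sym unfolding matching_def by (metis doubleton_eq_iff insertE singletonD)
  have eN: "e \<notin> N" using x e by blast
  have "y \<in> \<Union>N"
  proof (rule ccontr)
    assume "y \<notin> \<Union>N"
    then have "matching V R (insert e N)" using matching_insert mN y x by metis
    then have "card (insert e N) \<le> card N" using maxN by (auto simp: maximum_matching_def)
    then show False using eN finMN by simp
  qed
  then obtain f where f: "f \<in> N" "y \<in> f" by blast
  have fM: "f \<notin> M"
    using matching_disjoint[OF mM e(1), of f] f y x by blast
  let ?N' = "insert e (N - {f})"
  have yNf: "y \<notin> \<Union>(N - {f})"
    using matching_disjoint[OF mN f(1)] f by blast
  have "matching V R ?N'"
    using matching_insert[OF matching_subset[OF mN], of "N - {f}" x y] y x yNf by blast
  moreover have "card ?N' = card N"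
    using eN f finMN card_Suc_Diff1[of N f] by simp
  moreover have "t \<notin> \<Union>?N'"
    using tN x y \<open>y \<in> \<Union>N\<close> by blast
  ultimately have "?N' \<in> \<N>"
    using maxN by (auto simp: \<N>_def maximum_matching_def)
  then have "card (M \<inter> ?N') \<le> card (M \<inter> N)" by (rule N_max)
  moreover have "M \<inter> ?N' = insert e (M \<inter> N)" using e fM by blast
  ultimately show False using eN finMN by simp
qed

text \<open>
  The classes of \<open>l\<close> stand for the components of \<open>V - S\<close>. Parity of the components is not recorded;
  for \<open>S = {}\<close> the evenness of \<open>card V\<close> makes up for it.
\<close>

lemma weak_Tutte_Berge:
  fixes V :: "'a set"
  assumes "finite V" and symR: "symp R"
  shows "\<exists>S (l :: 'a \<Rightarrow> 'a set) M. S \<subseteq> V \<and> matching V R M \<and>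
    (\<forall>u\<in>V - S. \<forall>v\<in>V - S. R u v \<longrightarrow> l u = l v) \<and>
    card V + card S \<le> 2 * card M + card (l ` (V - S))"
  using assms(1)
proof (induction "card V" arbitrary: V rule: less_induct)
  case less
  obtain M where M: "maximum_matching V R M" using ex_maximum_matching[OF less.prems] by blast
  have mM: "matching V R M" using M by (simp add: maximum_matching_def)
  show ?case
  proof (cases "\<exists>v\<in>V. \<forall>N. maximum_matching V R N \<longrightarrow> v \<in> \<Union>N")
    case True
    then obtain v where v: "v \<in> V" "\<And>N. maximum_matching V R N \<Longrightarrow> v \<in> \<Union>N" by blast
    have "card (V - {v}) < card V" "finite (V - {v})"
      using card_Diff1_less[OF less.prems v(1)] less.prems by simp_all
    from less.hyps[OF this] obtain S and l :: "'a \<Rightarrow> 'a set" and M' where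
      S: "S \<subseteq> V - {v}" and mM': "matching (V - {v}) R M'"
      and l: "\<forall>u\<in>V - {v} - S. \<forall>w\<in>V - {v} - S. R u w \<longrightarrow> l u = l w"
      and le: "card (V - {v}) + card S \<le> 2 * card M' + card (l ` (V - {v} - S))"
      by blast
    have eq: "V - {v} - S = V - insert v S" by blast
    have "v \<notin> \<Union>M'" using mM' matching_subset_Pow by blast
    then have "\<not> maximum_matching V R M'" using v by blast
    moreover have "matching V R M'" using mM' matching_mono by blast
    ultimately have "card M' < card M"
      using M unfolding maximum_matching_def by (meson le_trans not_le)
    moreover have "card V = Suc (card (V - {v}))"
      using card_Suc_Diff1[OF less.prems v(1)] by simp
    moreover have "finite S" "v \<notin> S" using S less.prems finite_subset by blast+
    then have "card (insert v S) = Suc (card S)" by simp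
    ultimately have "card V + card (insert v S) \<le> 2 * card M + card (l ` (V - insert v S))"
      using le eq by simp
    then show ?thesis using S v mM l eq
      by (intro exI[of _ "insert v S"] exI[of _ l] exI[of _ M]) auto
  next
    case False
    define eqv where "eqv u v \<longleftrightarrow> u = v \<or> (\<forall>N. maximum_matching V R N \<longrightarrow> u \<notin> \<Union>N \<longrightarrow> v \<in> \<Union>N)" for u v
    define l where "l u = {w \<in> V. eqv u w}" for u
    have eqv_sym: "eqv u v \<Longrightarrow> eqv v u" for u v unfolding eqv_def by blast
    have eqv_trans: "eqv u v" if "eqv u t" "eqv t v" "t \<in> V" for u t v
    proof (cases "u = t \<or> t = v \<or> u = v")
      case True
      then show ?thesis using that by (auto simp: eqv_def)
    next
      case neq: False
      have ex: "\<exists>N. maximum_matching V R N \<and> t \<notin> \<Union>N" using False that(3) by blast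
      show ?thesis unfolding eqv_def
      proof (intro disjI2 allI impI)
        fix M assume "maximum_matching V R M" "u \<notin> \<Union>M"
        then show "v \<in> \<Union>M"
          using neq that unfolding eqv_def
          by (intro missed_by_maximum_matching_trans[OF less.prems sympD[OF symR] ex, of u v M]) blast+
      qed
    qed
    have l_eq: "l u = l v" if "eqv u v" "u \<in> V" "v \<in> V" for u v
      using that eqv_trans eqv_sym unfolding l_def by blast
    have "eqv u v" if "u \<in> V" "v \<in> V" "R u v" for u v
      unfolding eqv_def
    proof (rule disj_imp[THEN iffD2], intro impI allI)
      fix N assume nR: "u \<noteq> v" and N: "maximum_matching V R N" "u \<notin> \<Union>N"
      show "v \<in> \<Union>N"
      proof (rule ccontr)
        assume "v \<notin> \<Union>N"
        then have "matching V R (insert {u, v} N)"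
          using matching_insert N that nR unfolding maximum_matching_def by metis
        then have "card (insert {u, v} N) \<le> card N" using N by (simp add: maximum_matching_def)
        moreover have "finite N" using finite_matching less.prems N by (auto simp: maximum_matching_def)
        moreover have "{u, v} \<notin> N" using N by blast
        ultimately show False by simp
      qed
    qed
    then have compat: "\<forall>u\<in>V. \<forall>v\<in>V. R u v \<longrightarrow> l u = l v" using l_eq by blast
    have "inj_on l (V - \<Union>M)"
    proof (rule inj_onI)
      fix u v assume uv: "u \<in> V - \<Union>M" "v \<in> V - \<Union>M" "l u = l v"
      have "v \<in> l v" using uv by (simp add: l_def eqv_def)
      then have "v \<in> l u" using uv(3) by simp
      then have "eqv u v" by (simp add: l_def)
      then show "u = v" using M uv unfolding eqv_def by blast
    qed
    then have "card (V - \<Union>M) = card (l ` (V - \<Union>M))" by (simp add: card_image)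
    also have "\<dots> \<le> card (l ` V)" using less.prems by (intro card_mono) auto
    finally have "card (V - \<Union>M) \<le> card (l ` V)" .
    moreover have "\<Union>M \<subseteq> V" using mM matching_subset_Pow by blast
    then have "card (V - \<Union>M) = card V - card (\<Union>M)" "card (\<Union>M) \<le> card V"
      using less.prems by (simp_all add: card_Diff_subset[OF finite_subset] card_mono)
    ultimately have "card V \<le> 2 * card M + card (l ` V)"
      using card_Union_matching[OF less.prems mM] by simp
    then show ?thesis using mM compat
      by (intro exI[of _ "{}"] exI[of _ l] exI[of _ M]) auto
  qed
qed

lemma perfect_matching_or_barrier:
  fixes V :: "'a set"
  assumes "finite V" "even (card V)" and symR: "symp R"
  obtains (matching) M where "matching V R M" "\<Union>M = V"
  | (barrier) S and l :: "'a \<Rightarrow> 'a set" where "S \<subseteq> V"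
      "\<And>u v. u \<in> V - S \<Longrightarrow> v \<in> V - S \<Longrightarrow> R u v \<Longrightarrow> l u = l v"
      "card S + 2 \<le> card (l ` (V - S))"
      "\<And>s c. s \<in> S \<Longrightarrow> \<exists>u\<in>V - S. R s u \<and> l u \<noteq> c"
proof -
  define barrier where "barrier S \<longleftrightarrow> S \<subseteq> V \<and> (\<exists>l :: 'a \<Rightarrow> 'a set.
      (\<forall>u\<in>V - S. \<forall>v\<in>V - S. R u v \<longrightarrow> l u = l v) \<and> card S + 2 \<le> card (l ` (V - S)))" for S
  show ?thesis
  proof (cases "\<exists>S. barrier S")
    case True
    then obtain S0 where "barrier S0" by blast
    from ex_has_least_nat[of barrier, OF this, of card]
    obtain S where S: "barrier S" and min: "\<And>T. barrier T \<Longrightarrow> card S \<le> card T" by blast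
    from S[unfolded barrier_def] obtain l :: "'a \<Rightarrow> 'a set" where SV: "S \<subseteq> V"
      and l: "\<forall>u\<in>V - S. \<forall>v\<in>V - S. R u v \<longrightarrow> l u = l v"
      and le: "card S + 2 \<le> card (l ` (V - S))"
      by (elim conjE exE)
    have "\<exists>u\<in>V - S. R s u \<and> l u \<noteq> c" if s: "s \<in> S" for s c
    proof (rule ccontr)
      assume contr: "\<not> (\<exists>u\<in>V - S. R s u \<and> l u \<noteq> c)"
      let ?S = "S - {s}" and ?l = "l(s := c)"
      have fS: "finite S" using SV assms(1) finite_subset by blast
      have VS: "V - ?S = insert s (V - S)" using s SV by blast
      have "\<forall>u\<in>V - ?S. \<forall>v\<in>V - ?S. R u v \<longrightarrow> ?l u = ?l v"
      proof (intro ballI impI)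
        fix u v assume uv: "u \<in> V - ?S" "v \<in> V - ?S" "R u v"
        have c: "l w = c" if "w \<in> V - S" "R s w" for w using contr that by blast
        have *: "w \<in> V - S" if "w \<in> V - ?S" "w \<noteq> s" for w using that by blast
        consider "u = s" "v = s" | "u = s" "v \<noteq> s" | "u \<noteq> s" "v = s" | "u \<noteq> s" "v \<noteq> s"
          by blast
        then show "?l u = ?l v"
        proof cases
          case 2
          then show ?thesis using c[OF *[OF uv(2)]] uv(3) by simp
        next
          case 3
          then show ?thesis using c[OF *[OF uv(1)]] sympD[OF symR uv(3)] by simp
        next
          case 4
          then show ?thesis using l *[OF uv(1)] *[OF uv(2)] uv(3) by simp
        qed simp
      qed
      moreover have "l ` (V - S) \<subseteq> ?l ` (V - ?S)"
        unfolding VS using s by (auto simp: image_iff)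
      then have "card (l ` (V - S)) \<le> card (?l ` (V - ?S))"
        using assms(1) by (intro card_mono) auto
      then have "card ?S + 2 \<le> card (?l ` (V - ?S))"
        using le card_Diff1_le[of S s] by linarith
      ultimately have "barrier ?S" unfolding barrier_def using SV by blast
      then have "card S \<le> card ?S" by (rule min)
      then show False using card_Diff1_less[OF fS s] by simp
    qed
    then show ?thesis using barrier[OF SV _ le] l by simp
  next
    case False
    obtain S and l :: "'a \<Rightarrow> 'a set" and M where SV: "S \<subseteq> V" and M: "matching V R M"
      and l: "\<forall>u\<in>V - S. \<forall>v\<in>V - S. R u v \<longrightarrow> l u = l v"
      and le: "card V + card S \<le> 2 * card M + card (l ` (V - S))"
      using weak_Tutte_Berge[OF assms(1) symR] by (elim exE conjE)
    have "\<not> card S + 2 \<le> card (l ` (V - S))"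
    proof
      assume "card S + 2 \<le> card (l ` (V - S))"
      with SV l have "barrier S" unfolding barrier_def by (intro conjI exI[of _ l])
      with False show False by simp
    qed
    then have "card V < 2 * card M + 2" using le by linarith
    then have "card V \<le> card (\<Union>M)"
      using card_Union_matching[OF assms(1) M] assms(2) by (auto elim!: evenE)
    moreover have "\<Union>M \<subseteq> V" using matching_subset_Pow[OF M] by blast
    ultimately have "\<Union>M = V" using assms(1) by (simp add: card_seteq)
    then show ?thesis using matching M by blast
  qed
qed

section \<open>Forests with even bags\<close>

locale closed_neighbourhoods =
  fixes V :: "'a set" and N :: "'a \<Rightarrow> 'a set"
  assumes finite_V: "finite V"
    and V_nonempty: "V \<noteq> {}"
    and N_subset: "x \<in> V \<Longrightarrow> N x \<subseteq> V"
    and N_refl: "x \<in> V \<Longrightarrow> x \<in> N x"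
    and N_sym: "x \<in> V \<Longrightarrow> y \<in> N x \<Longrightarrow> x \<in> N y"
    and N_cut: "U \<subseteq> V \<Longrightarrow> U \<noteq> {} \<Longrightarrow> U \<noteq> V \<Longrightarrow> \<exists>u\<in>U. \<exists>v\<in>V - U. v \<in> N u"
begin

text \<open>
  \<open>rk\<close> makes the parent map \<open>b\<close> acyclic and \<open>rt v\<close> is the root of the tree of \<open>v\<close>; the load \<open>c\<close>
  counts children that have already been hung below a vertex from outside \<open>U\<close>.
\<close>

definition even_orientation ::
  "'a set \<Rightarrow> ('a \<Rightarrow> nat) \<Rightarrow> ('a \<Rightarrow> 'a) \<Rightarrow> ('a \<Rightarrow> nat) \<Rightarrow> ('a \<Rightarrow> 'a) \<Rightarrow> bool" where
  "even_orientation U c b rk rt \<longleftrightarrow> (\<forall>v\<in>U. b v \<in> N v \<and> b v \<in> U \<and> rt v \<in> U \<and> b (rt v) = rt v \<and>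
    rt (b v) = rt v \<and> (b v = v \<longrightarrow> rt v = v) \<and> (b v \<noteq> v \<longrightarrow> rk (b v) < rk v) \<and>
    even (card {u \<in> U. b u = v} + c v))"

lemma even_orientation_add_root:
  assumes b: "even_orientation U c b rk rt" and v: "v \<in> V" "v \<notin> U" "odd (c v)"
  shows "even_orientation (insert v U) c (b(v := v)) rk (rt(v := v))"
  unfolding even_orientation_def
proof
  fix w assume w: "w \<in> insert v U"
  have bU: "b u \<in> U" "rt u \<in> U" if "u \<in> U" for u
    using b that by (simp_all add: even_orientation_def)
  show "(b(v := v)) w \<in> N w \<and> (b(v := v)) w \<in> insert v U \<and> (rt(v := v)) w \<in> insert v U \<and>
    (b(v := v)) ((rt(v := v)) w) = (rt(v := v)) w \<and>
    (rt(v := v)) ((b(v := v)) w) = (rt(v := v)) w \<and>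
    ((b(v := v)) w = w \<longrightarrow> (rt(v := v)) w = w) \<and>
    ((b(v := v)) w \<noteq> w \<longrightarrow> rk ((b(v := v)) w) < rk w) \<and>
    even (card {u \<in> insert v U. (b(v := v)) u = w} + c w)"
  proof (cases "w = v")
    case True
    have singleton: "{u \<in> insert v U. (b(v := v)) u = v} = {v}" using bU v(2) by auto
    show ?thesis unfolding True singleton using v N_refl by simp
  next
    case False
    then have wU: "w \<in> U" using w by simp
    have "{u \<in> insert v U. (b(v := v)) u = w} = {u \<in> U. b u = w}" using False v(2) by auto
    moreover have "b w \<noteq> v" "rt w \<noteq> v" using bU[OF wU] v(2) by auto
    ultimately show ?thesis using b False wU by (simp add: even_orientation_def)
  qed
qed

lemma even_orientation_add_child:
  assumes b: "even_orientation U (c(u := Suc (c u))) b rk rt" and "finite U"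
    and v: "v \<notin> U" "even (c v)" and u: "u \<in> U" "u \<in> N v"
  shows "even_orientation (insert v U) c (b(v := u)) (rk(v := Suc (rk u))) (rt(v := rt u))"
    (is "even_orientation _ _ ?b ?rk ?rt")
  unfolding even_orientation_def
proof
  fix w assume w: "w \<in> insert v U"
  have bU: "b x \<in> U" "rt x \<in> U" if "x \<in> U" for x
    using b that by (simp_all add: even_orientation_def)
  have uv: "u \<noteq> v" using u v by auto
  show "?b w \<in> N w \<and> ?b w \<in> insert v U \<and> ?rt w \<in> insert v U \<and>
    ?b (?rt w) = ?rt w \<and> ?rt (?b w) = ?rt w \<and> (?b w = w \<longrightarrow> ?rt w = w) \<and>
    (?b w \<noteq> w \<longrightarrow> ?rk (?b w) < ?rk w) \<and> even (card {u \<in> insert v U. ?b u = w} + c w)"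
  proof (cases "w = v")
    case True
    have empty: "{x \<in> insert v U. ?b x = v} = {}" using bU v(1) uv by auto
    have "even (card {x \<in> insert v U. ?b x = w} + c w)" unfolding True empty using v by simp
    moreover have "rt u \<noteq> v" using bU[OF u(1)] v(1) by auto
    ultimately show ?thesis using b True u uv bU[OF u(1)] by (simp add: even_orientation_def)
  next
    case False
    then have wU: "w \<in> U" using w by simp
    have "{x \<in> insert v U. ?b x = w} = (if w = u then insert v {x \<in> U. b x = w} else {x \<in> U. b x = w})"
      using v(1) by auto
    then have "card {x \<in> insert v U. ?b x = w} + c w = card {x \<in> U. b x = w} + (c(u := Suc (c u))) w"
      using v(1) \<open>finite U\<close> by (simp only: split: if_splits) simp_all
    moreover have "even (card {x \<in> U. b x = w} + (c(u := Suc (c u))) w)"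
      using b wU unfolding even_orientation_def by blast
    ultimately have "even (card {x \<in> insert v U. ?b x = w} + c w)" by (simp only:)
    moreover have "b w \<noteq> v" "rt w \<noteq> v" using bU[OF wU] v(1) by auto
    ultimately show ?thesis using b False wU by (simp add: even_orientation_def)
  qed
qed

lemma ex_even_orientation:
  assumes "even (card V)"
  shows "\<exists>b rk rt. even_orientation V (\<lambda>_. 0) b rk rt"
proof -
  define good where "good U \<longleftrightarrow> (\<forall>c. even (\<Sum>u\<in>U. Suc (c u)) \<longrightarrow>
    (\<exists>b rk rt. even_orientation U c b rk rt))" for U
  have step: "good (insert v U)"
    if U: "U \<subseteq> V" "good U" and v: "v \<in> V" "v \<notin> U" and u: "u \<in> U" "v \<in> N u" for U u v
    unfolding good_def
  proof (intro allI impI)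
    fix c :: "'a \<Rightarrow> nat"
    assume ev: "even (\<Sum>u\<in>insert v U. Suc (c u))"
    have fU: "finite U" using finite_subset[OF U(1) finite_V] .
    have sum: "(\<Sum>u\<in>insert v U. Suc (c u)) = Suc (c v) + (\<Sum>u\<in>U. Suc (c u))"
      using v fU by simp
    show "\<exists>b rk rt. even_orientation (insert v U) c b rk rt"
    proof (cases "even (c v)")
      case False
      then have "even (\<Sum>u\<in>U. Suc (c u))" using ev sum by simp
      then obtain b rk rt where "even_orientation U c b rk rt"
        using U(2) unfolding good_def by blast
      from even_orientation_add_root[OF this v False] show ?thesis by blast
    next
      case True
      let ?c = "c(u := Suc (c u))"
      have "(\<Sum>x\<in>U. Suc (?c x)) = Suc (Suc (c u)) + (\<Sum>x\<in>U - {u}. Suc (?c x))"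
        using sum.remove[OF fU u(1), of "\<lambda>x. Suc (?c x)"] by simp
      also have "(\<Sum>x\<in>U - {u}. Suc (?c x)) = (\<Sum>x\<in>U - {u}. Suc (c x))"
        by (intro sum.cong) auto
      also have "Suc (Suc (c u)) + \<dots> = Suc (\<Sum>x\<in>U. Suc (c x))"
        using sum.remove[OF fU u(1), of "\<lambda>x. Suc (c x)"] by simp
      finally have "even (\<Sum>x\<in>U. Suc (?c x))" using ev sum True by simp
      then obtain b rk rt where b: "even_orientation U ?c b rk rt"
        using U(2) unfolding good_def by blast
      have "u \<in> N v" using u U(1) N_sym by blast
      from even_orientation_add_child[OF b fU v(2) True u(1) this] show ?thesis by blast
    qed
  qed
  have base: "good {r}" if r: "r \<in> V" for r
    unfolding good_def
  proof (intro allI impI)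
    fix c :: "'a \<Rightarrow> nat"
    assume "even (\<Sum>u\<in>{r}. Suc (c u))"
    moreover have "{u. u = r} = {r}" by simp
    ultimately have "even_orientation {r} c (\<lambda>x. x) (\<lambda>_. 0) (\<lambda>x. x)"
      using N_refl[OF r] by (simp add: even_orientation_def conj_commute Collect_conv_if)
    then show "\<exists>b rk rt. even_orientation {r} c b rk rt" by blast
  qed
  let ?A = "{U. U \<subseteq> V \<and> U \<noteq> {} \<and> good U}"
  have fin: "finite ?A" by (rule finite_subset[of ?A "Pow V"]) (auto simp: finite_V)
  obtain r where "r \<in> V" using V_nonempty by blast
  then have "{r} \<in> ?A" using base by simp
  then have "?A \<noteq> {}" by blast
  from ex_arg_max_finite[OF fin this, of card]
  obtain U where U: "U \<in> ?A" and max: "\<forall>W\<in>?A. card W \<le> card U" by (elim bexE)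
  from U have UV: "U \<subseteq> V" "U \<noteq> {}" "good U" by simp_all
  have "U = V"
  proof (rule ccontr)
    assume "U \<noteq> V"
    then obtain u v where uv: "u \<in> U" "v \<in> V - U" "v \<in> N u" using N_cut[OF UV(1,2)] by blast
    then have "good (insert v U)" using step[OF UV(1,3), of v u] by simp
    then have "insert v U \<in> ?A" using UV uv by simp
    then have "card (insert v U) \<le> card U" by (rule max[rule_format])
    then show False using uv(2) finite_subset[OF UV(1) finite_V] by simp
  qed
  then have "good V" using UV(3) by simp
  from this[unfolded good_def, rule_format, of "\<lambda>_. 0"] show ?thesis using assms by simp
qed

end

locale evenly_oriented = closed_neighbourhoods +
  fixes b :: "'a \<Rightarrow> 'a" and rk :: "'a \<Rightarrow> nat" and rt :: "'a \<Rightarrow> 'a"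
  assumes oriented: "even_orientation V (\<lambda>_. 0) b rk rt"
begin

lemma b_N: "v \<in> V \<Longrightarrow> b v \<in> N v"
  and b_V: "v \<in> V \<Longrightarrow> b v \<in> V"
  and rt_V: "v \<in> V \<Longrightarrow> rt v \<in> V"
  and b_rt: "v \<in> V \<Longrightarrow> b (rt v) = rt v"
  and rt_b: "v \<in> V \<Longrightarrow> rt (b v) = rt v"
  and rt_root: "v \<in> V \<Longrightarrow> b v = v \<Longrightarrow> rt v = v"
  and rk_b: "v \<in> V \<Longrightarrow> b v \<noteq> v \<Longrightarrow> rk (b v) < rk v"
  and even_bag: "v \<in> V \<Longrightarrow> even (card {u \<in> V. b u = v})"
  using oriented by (simp_all add: even_orientation_def)

definition bag :: "'a \<Rightarrow> 'a set" where
  "bag w = {u \<in> V. b u = w}"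

lemma finite_bag: "finite (bag w)"
  using finite_V by (simp add: bag_def)

lemma bag_subset_N: "w \<in> V \<Longrightarrow> bag w \<subseteq> N w"
  using b_N N_sym by (auto simp: bag_def)

text \<open>The number of pairs fixed at \<open>w\<close>: a root lends one of its pairs to the whole tree.\<close>

definition tau :: "'a \<Rightarrow> nat" where
  "tau w = (if b w = w then card (bag w) - 2 else card (bag w)) div 2"

lemma card_bag:
  assumes w: "w \<in> V"
  shows "card (bag w) = 2 * tau w + (if b w = w then 2 else 0)"
proof (cases "b w = w")
  case True
  then have "w \<in> bag w" using w by (simp add: bag_def)
  then have "card (bag w) \<noteq> 0" using finite_bag by auto
  moreover have "even (card (bag w))" using even_bag[OF w] by (simp add: bag_def)
  ultimately show ?thesis using True by (auto simp: tau_def elim!: evenE)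
next
  case False
  then show ?thesis using even_bag[OF w] by (simp add: tau_def bag_def)
qed

lemma reroot:
  assumes "x \<in> V"
  shows "\<exists>c. (\<forall>v\<in>V. c v \<in> N v \<and> rt (c v) = rt v) \<and> c x = x \<and>
    (\<forall>v\<in>V. rk x < rk v \<or> rt v \<noteq> rt x \<longrightarrow> c v = b v) \<and>
    (\<forall>w\<in>V. card {v \<in> V. c v = w} + (if w = rt x then 2 else 0) =
      card (bag w) + (if w = x then 2 else 0))"
  using assms
proof (induction "rk x" arbitrary: x rule: less_induct)
  case less
  show ?case
  proof (cases "b x = x")
    case True
    then show ?thesis
      using less.prems b_N rt_b rt_root by (intro exI[of _ b]) (simp add: bag_def)
  next
    case False
    let ?u = "b x"
    have uV: "?u \<in> V" using less.prems b_V by simp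
    from less.hyps[OF rk_b[OF less.prems False] uV] obtain c where
      c: "\<forall>v\<in>V. c v \<in> N v \<and> rt (c v) = rt v" "c ?u = ?u"
      "\<forall>v\<in>V. rk ?u < rk v \<or> rt v \<noteq> rt ?u \<longrightarrow> c v = b v"
      "\<forall>w\<in>V. card {v \<in> V. c v = w} + (if w = rt ?u then 2 else 0) =
        card (bag w) + (if w = ?u then 2 else 0)"
      by (elim exE conjE)
    have cx: "c x = ?u" using c(3) rk_b[OF less.prems False] less.prems by simp
    have rtu: "rt ?u = rt x" using rt_b less.prems by simp
    let ?c = "c(?u := x, x := x)"
    have 1: "\<forall>v\<in>V. ?c v \<in> N v \<and> rt (?c v) = rt v"
      using c(1) rtu b_N[OF less.prems] N_refl[OF less.prems] N_sym[OF less.prems] by simp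
    have 2: "\<forall>v\<in>V. rk x < rk v \<or> rt v \<noteq> rt x \<longrightarrow> ?c v = b v"
      using c(3) rtu rk_b[OF less.prems False] by auto
    have 3: "card {v \<in> V. ?c v = w} + (if w = rt x then 2 else 0) =
      card (bag w) + (if w = x then 2 else 0)" if w: "w \<in> V" for w
    proof -
      consider "w = x" | "w = ?u" | "w \<noteq> x" "w \<noteq> ?u" by blast
      then show ?thesis
      proof cases
        case 1
        have "{v \<in> V. ?c v = x} = insert x (insert ?u {v \<in> V. c v = x})"
          using less.prems uV by auto
        moreover have "x \<notin> {v \<in> V. c v = x}" "?u \<notin> {v \<in> V. c v = x}"
          using cx c(2) False by auto
        ultimately have "card {v \<in> V. ?c v = x} = card {v \<in> V. c v = x} + 2"
          using finite_V False by simp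
        then show ?thesis using c(4)[rule_format, OF w] rtu False 1 by simp
      next
        case 2
        have "{v \<in> V. c v = ?u} = insert x (insert ?u {v \<in> V. ?c v = ?u})"
          using less.prems uV cx c(2) by auto
        moreover have "x \<notin> {v \<in> V. ?c v = ?u}" "?u \<notin> {v \<in> V. ?c v = ?u}"
          using False by auto
        ultimately have "card {v \<in> V. c v = ?u} = card {v \<in> V. ?c v = ?u} + 2"
          using finite_V False by simp
        then show ?thesis using c(4)[rule_format, OF w] rtu False 2 by simp
      next
        case 3
        then have "{v \<in> V. ?c v = w} = {v \<in> V. c v = w}"
          using cx c(2) by auto
        then show ?thesis using c(4)[rule_format, OF w] rtu 3 by simp
      qed
    qed
    show ?thesis using 1 2 3 by (intro exI[of _ ?c]) simp
  qed
qed

lemma reroot_all: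
  assumes f: "\<And>r. r \<in> V \<Longrightarrow> b r = r \<Longrightarrow> f r \<in> V \<and> rt (f r) = r"
  shows "\<exists>c. (\<forall>v\<in>V. c v \<in> N v) \<and>
    (\<forall>w\<in>V. card {v \<in> V. c v = w} = 2 * tau w + (if f (rt w) = w then 2 else 0))"
proof -
  have "\<forall>r. \<exists>c. r \<in> V \<and> b r = r \<longrightarrow> (\<forall>v\<in>V. c v \<in> N v \<and> rt (c v) = rt v) \<and>
    (\<forall>v\<in>V. rt v \<noteq> r \<longrightarrow> c v = b v) \<and>
    (\<forall>w\<in>V. card {v \<in> V. c v = w} + (if w = r then 2 else 0) =
      card (bag w) + (if w = f r then 2 else 0))"
  proof
    fix r
    show "\<exists>c. r \<in> V \<and> b r = r \<longrightarrow> (\<forall>v\<in>V. c v \<in> N v \<and> rt (c v) = rt v) \<and>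
      (\<forall>v\<in>V. rt v \<noteq> r \<longrightarrow> c v = b v) \<and>
      (\<forall>w\<in>V. card {v \<in> V. c v = w} + (if w = r then 2 else 0) =
        card (bag w) + (if w = f r then 2 else 0))"
    proof (cases "r \<in> V \<and> b r = r")
      case True
      then have fr: "f r \<in> V" "rt (f r) = r" using f by simp_all
      from reroot[OF fr(1)] obtain c where
        "\<forall>v\<in>V. c v \<in> N v \<and> rt (c v) = rt v"
        "\<forall>v\<in>V. rk (f r) < rk v \<or> rt v \<noteq> rt (f r) \<longrightarrow> c v = b v"
        "\<forall>w\<in>V. card {v \<in> V. c v = w} + (if w = rt (f r) then 2 else 0) =
          card (bag w) + (if w = f r then 2 else 0)"
        by (elim exE conjE)
      then show ?thesis using fr(2) by (intro exI[of _ c]) simp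
    next
      case False
      then show ?thesis by blast
    qed
  qed
  from choice[OF this] obtain c where
    c0: "\<forall>r. r \<in> V \<and> b r = r \<longrightarrow> (\<forall>v\<in>V. c r v \<in> N v \<and> rt (c r v) = rt v) \<and>
    (\<forall>v\<in>V. rt v \<noteq> r \<longrightarrow> c r v = b v) \<and>
    (\<forall>w\<in>V. card {v \<in> V. c r v = w} + (if w = r then 2 else 0) =
      card (bag w) + (if w = f r then 2 else 0))"
    by (elim exE)
  note c = c0[THEN spec, THEN mp, OF conjI]
  let ?c = "\<lambda>v. c (rt v) v"
  have "?c v \<in> N v" if "v \<in> V" for v
    using c[of "rt v"] that rt_V b_rt by simp
  moreover have "card {v \<in> V. ?c v = w} = 2 * tau w + (if f (rt w) = w then 2 else 0)"
    if w: "w \<in> V" for w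
  proof -
    let ?r = "rt w"
    have r: "?r \<in> V" "b ?r = ?r" using w rt_V b_rt by simp_all
    note cr = c[OF r]
    have "{v \<in> V. ?c v = w} = {v \<in> V. c ?r v = w}"
    proof (intro Collect_cong conj_cong refl)
      fix v assume v: "v \<in> V"
      have v': "rt v \<in> V" "b (rt v) = rt v" using v rt_V b_rt by simp_all
      show "(c (rt v) v = w) = (c ?r v = w)"
      proof (cases "rt v = ?r")
        case False
        have "rt (c (rt v) v) = rt v" "rt (c ?r v) = rt v" using c[OF v'] cr v by simp_all
        then show ?thesis using False by auto
      qed simp
    qed
    moreover have "card {v \<in> V. c ?r v = w} + (if w = ?r then 2 else 0) =
      card (bag w) + (if w = f ?r then 2 else 0)"
      using cr w by blast
    moreover have "b w = w \<longleftrightarrow> w = ?r" using w rt_root r by metis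
    ultimately show ?thesis using card_bag[OF w] by auto
  qed
  ultimately show ?thesis by (intro exI[of _ ?c]) simp
qed

end

section \<open>Matching the pairs\<close>

context evenly_oriented
begin

definition roots :: "'a set" where
  "roots = {r \<in> V. b r = r}"

text \<open>
  \<open>Inl r\<close> is the movable pair of the tree with root \<open>r\<close>, and \<open>Inr (w, j)\<close> the \<open>j\<close>-th pair fixed
  at \<open>w\<close>. The territory of a pair consists of the vertices near which it can be placed.
\<close>

definition tokens :: "('a + 'a \<times> nat) set" where
  "tokens = Inl ` roots \<union> Inr ` (SIGMA w:V. {..<tau w})"

definition territory :: "'a + 'a \<times> nat \<Rightarrow> 'a set" where
  "territory = case_sum (\<lambda>r. \<Union>(N ` {v \<in> V. rt v = r})) (\<lambda>(w, j). N w)"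

definition meets :: "'a + 'a \<times> nat \<Rightarrow> 'a + 'a \<times> nat \<Rightarrow> bool" where
  "meets s t \<longleftrightarrow> territory s \<inter> territory t \<noteq> {}"

lemma territory_simps [simp]:
  "territory (Inl r) = \<Union>(N ` {v \<in> V. rt v = r})"
  "territory (Inr (w, j)) = N w"
  by (simp_all add: territory_def)

lemma symp_meets: "symp meets"
  by (auto simp: meets_def symp_def)

lemma finite_tokens: "finite tokens"
  using finite_V by (simp add: tokens_def roots_def)

lemma roots_eq: "v \<in> V \<Longrightarrow> b v = v \<longleftrightarrow> rt v = v"
  using rt_root b_rt by metis

lemma card_closed_eq_sum_bag:
  assumes "U \<subseteq> V" "\<And>v. v \<in> V \<Longrightarrow> b v \<in> U \<longleftrightarrow> v \<in> U"
  shows "card U = (\<Sum>w\<in>U. card (bag w))"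
proof -
  have "U = \<Union>(bag ` U)"
    using assms by (auto simp: bag_def)
  then have "card U = card (\<Union>w\<in>U. bag w)" by simp
  also have "\<dots> = (\<Sum>w\<in>U. card (bag w))"
    using finite_subset[OF assms(1) finite_V] finite_bag
    by (intro card_UN_disjoint) (auto simp: bag_def)
  finally show ?thesis .
qed

lemma sum_card_bag:
  assumes "U \<subseteq> V"
  shows "(\<Sum>w\<in>U. card (bag w)) = (\<Sum>w\<in>U. 2 * tau w) + 2 * card (U \<inter> roots)"
proof -
  have fin: "finite U" using finite_subset[OF assms finite_V] .
  have "(\<Sum>w\<in>U. card (bag w)) = (\<Sum>w\<in>U. 2 * tau w + (if w \<in> roots then 2 else 0))"
    using assms card_bag by (intro sum.cong) (auto simp: roots_def)
  also have "\<dots> = (\<Sum>w\<in>U. 2 * tau w) + (\<Sum>w\<in>U. if w \<in> roots then 2 else 0)"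
    by (rule sum.distrib)
  also have "(\<Sum>w\<in>U. if w \<in> roots then 2 else 0) = 2 * card (U \<inter> roots)"
    using fin by (simp add: sum.If_cases)
  finally show ?thesis .
qed

lemma card_tokens: "2 * card tokens = card V"
proof -
  have "card tokens = card (Inl ` roots :: ('a + 'a \<times> nat) set) +
      card (Inr ` (SIGMA w:V. {..<tau w}) :: ('a + 'a \<times> nat) set)"
    unfolding tokens_def using finite_V by (intro card_Un_disjoint) (auto simp: roots_def)
  also have "\<dots> = card roots + (\<Sum>w\<in>V. tau w)"
    using finite_V by (simp add: card_image card_SigmaI)
  finally have "2 * card tokens = 2 * card roots + (\<Sum>w\<in>V. 2 * tau w)"
    by (simp add: sum_distrib_left)
  moreover have "V \<inter> roots = roots" by (auto simp: roots_def)
  ultimately show ?thesis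
    using card_closed_eq_sum_bag[of V] sum_card_bag[of V] b_V by simp
qed

lemma sum_tau_le_card_Union:
  assumes W: "W \<subseteq> V" "W \<noteq> {}"
  shows "(\<Sum>w\<in>W. 2 * tau w) + 2 \<le> card (\<Union>w\<in>W. insert w (insert (b w) (bag w)))"
    (is "_ \<le> card ?Z")
proof -
  have fin: "finite W" using finite_subset[OF W(1) finite_V] .
  then have finZ: "finite ?Z" using finite_bag by simp
  have "card (\<Union>w\<in>W. bag w) = (\<Sum>w\<in>W. card (bag w))"
    using fin finite_bag by (intro card_UN_disjoint) (auto simp: bag_def)
  then have eq: "card (\<Union>w\<in>W. bag w) = (\<Sum>w\<in>W. 2 * tau w) + 2 * card (W \<inter> roots)"
    using sum_card_bag[OF W(1)] by simp
  show ?thesis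
  proof (cases "W \<inter> roots = {}")
    case False
    then have "card (W \<inter> roots) \<noteq> 0" using fin by simp
    moreover have "card (\<Union>w\<in>W. bag w) \<le> card ?Z" using finZ by (intro card_mono) auto
    ultimately show ?thesis using eq by linarith
  next
    case True
    \<comment> \<open>A vertex of least rank in \<open>W\<close> and its parent lie in no bag of \<open>W\<close>.\<close>
    obtain w where w: "w \<in> W" and min: "\<And>v. v \<in> W \<Longrightarrow> rk w \<le> rk v"
      using W(2) ex_has_least_nat[of "\<lambda>w. w \<in> W" _ rk] by blast
    have wV: "w \<in> V" "b w \<in> V" using w W b_V by auto
    have root: "b v \<noteq> v" if "v \<in> W" for v using that True W by (auto simp: roots_def)
    have lt: "rk (b w) < rk w" using rk_b root w wV by simp
    then have "b w \<notin> W" using min by fastforce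
    have "b (b w) \<notin> W"
    proof (cases "b (b w) = b w")
      case False
      then have "rk (b (b w)) < rk w" using rk_b[OF wV(2)] lt by simp
      then show ?thesis using min by fastforce
    qed (use \<open>b w \<notin> W\<close> in simp)
    have "w \<notin> (\<Union>w\<in>W. bag w)" "b w \<notin> (\<Union>w\<in>W. bag w)"
      using \<open>b w \<notin> W\<close> \<open>b (b w) \<notin> W\<close> by (auto simp: bag_def)
    moreover have "finite (\<Union>w\<in>W. bag w)" using fin finite_bag by simp
    ultimately have "card (insert w (insert (b w) (\<Union>w\<in>W. bag w))) = card (\<Union>w\<in>W. bag w) + 2"
      using root[OF w] by simp
    moreover have "insert w (insert (b w) (\<Union>w\<in>W. bag w)) \<subseteq> ?Z" using w by auto
    ultimately have "card (\<Union>w\<in>W. bag w) + 2 \<le> card ?Z" using card_mono[OF finZ] by metis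
    then show ?thesis using eq by linarith
  qed
qed

lemma no_barrier:
  fixes l :: "'a + 'a \<times> nat \<Rightarrow> ('a + 'a \<times> nat) set"
  assumes two: "\<And>R. R \<subseteq> V \<Longrightarrow> R \<noteq> {} \<Longrightarrow> \<Union>(N ` R) \<noteq> V \<Longrightarrow> 2 \<le> card (\<Union>(N ` R) - R)"
    and S: "S \<subseteq> tokens"
    and l: "\<And>s t. s \<in> tokens - S \<Longrightarrow> t \<in> tokens - S \<Longrightarrow> meets s t \<Longrightarrow> l s = l t"
    and le: "card S + 2 \<le> card (l ` (tokens - S))"
    and min: "\<And>s c. s \<in> S \<Longrightarrow> \<exists>t\<in>tokens - S. meets s t \<and> l t \<noteq> c"
  shows False
proof -
  define Q where "Q = tokens - S"
  define X where "X i = (\<Union>t\<in>{t \<in> Q. l t = i}. territory t)" for i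
  have finQ: "finite Q" using finite_tokens by (simp add: Q_def)
  have finS: "finite S" using finite_subset[OF S finite_tokens] .
  have X_disj: "i = j" if x: "x \<in> X i" "x \<in> X j" for x i j
  proof -
    obtain s t where "s \<in> Q" "l s = i" "x \<in> territory s" "t \<in> Q" "l t = j" "x \<in> territory t"
      using x unfolding X_def by blast
    then show ?thesis using l[of s t] unfolding Q_def meets_def by blast
  qed
  \<comment> \<open>By minimality, an element of \<open>S\<close> meets two classes, so its territory is not covered by one.\<close>
  have absorb: "s \<notin> S \<and> l s = l t"
    if s: "s \<in> tokens" and t: "t \<in> Q" and sub: "territory s \<subseteq> territory t"
      and ne: "territory s \<noteq> {}" for s t
  proof -
    have *: "l u = l t" if "u \<in> Q" "meets s u" for u
    proof -
      have "meets t u" using that sub by (auto simp: meets_def)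
      then show ?thesis using l[of t u] t that by (simp add: Q_def)
    qed
    have "s \<notin> S"
    proof
      assume "s \<in> S"
      from min[OF this, of "l t"] obtain u where "u \<in> Q" "meets s u" "l u \<noteq> l t"
        unfolding Q_def by (elim bexE conjE)
      then show False using * by simp
    qed
    moreover have "meets s s" using ne by (simp add: meets_def)
    ultimately show ?thesis using *[of s] s by (simp add: Q_def)
  qed
  define A where "A = {r \<in> roots. Inl r \<notin> S}"
  define Va where "Va = {v \<in> V. rt v \<in> A}"
  define Vb where "Vb = V - Va"
  define W where "W = {w \<in> Vb. 0 < tau w \<and> Inr (w, 0) \<notin> S}"
  define lam where "lam w = l (Inr (w, 0))" for w
  define \<Lambda> where "\<Lambda> = lam ` W"
  define Z where "Z w = insert w (insert (b w) (bag w))" for w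
  have VbV: "Vb \<subseteq> V" and WVb: "W \<subseteq> Vb" by (auto simp: Vb_def W_def)
  have fin: "finite Vb" "finite W"
    using finite_subset[OF VbV finite_V] finite_subset[OF subset_trans[OF WVb VbV] finite_V] .
  have NV: "N w \<noteq> {}" if "w \<in> V" for w using N_refl[OF that] by blast
  have in_S: "Inr (w, j) \<in> S" if "w \<in> Vb - W" "j < tau w" for w j
  proof (rule ccontr)
    assume "Inr (w, j) \<notin> S"
    then have "Inr (w, j) \<in> Q" using that VbV by (auto simp: Q_def tokens_def)
    moreover have "Inr (w, 0) \<in> tokens" using that VbV by (auto simp: tokens_def)
    ultimately have "Inr (w, 0) \<notin> S"
      using absorb[of "Inr (w, 0)" "Inr (w, j)"] NV that VbV by auto
    then show False using that by (auto simp: W_def)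
  qed
  have N_W: "N w \<subseteq> X (lam w)" if "w \<in> W" for w
  proof -
    have "Inr (w, 0) \<in> Q" using that VbV by (auto simp: W_def Q_def tokens_def)
    then show ?thesis unfolding X_def lam_def by force
  qed
  have Z_N: "Z w \<subseteq> N w" if "w \<in> V" for w
    using bag_subset_N b_N N_refl that by (simp add: Z_def)
  have rt_Z: "rt v = rt w" "v \<in> V" if "v \<in> Z w" "w \<in> V" for v w
    using that rt_b b_V by (auto simp: Z_def bag_def)
  then have Z_Vb: "Z w \<subseteq> Vb" if "w \<in> Vb" for w
    using that VbV unfolding Vb_def Va_def by fastforce

  let ?SA = "Inl ` (roots - A) :: ('a + 'a \<times> nat) set"
  let ?SW = "Inr ` (SIGMA w:Vb - W. {..<tau w}) :: ('a + 'a \<times> nat) set"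
  have "?SA \<union> ?SW \<subseteq> S" using in_S by (auto simp: A_def)
  then have "card (?SA \<union> ?SW) \<le> card S" by (rule card_mono[OF finS])
  moreover have "finite roots" using finite_V by (simp add: roots_def)
  then have "card (?SA \<union> ?SW) = card ?SA + card ?SW"
    using fin by (intro card_Un_disjoint) auto
  moreover have "card ?SA = card (roots - A)" "card ?SW = (\<Sum>w\<in>Vb - W. tau w)"
    using fin by (simp_all add: card_image)
  ultimately have 1: "2 * card (roots - A) + (\<Sum>w\<in>Vb - W. 2 * tau w) \<le> 2 * card S"
    by (simp add: sum_distrib_left[symmetric])
  have "Vb \<inter> roots = roots - A"
    using roots_eq by (auto simp: Vb_def Va_def roots_def)
  moreover have "b v \<in> Vb \<longleftrightarrow> v \<in> Vb" if "v \<in> V" for v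
    using that rt_b b_V by (auto simp: Vb_def Va_def)
  ultimately have "card Vb = (\<Sum>w\<in>Vb. 2 * tau w) + 2 * card (roots - A)"
    using card_closed_eq_sum_bag[OF VbV] sum_card_bag[OF VbV] by simp
  then have 2: "card Vb \<le> 2 * card S + (\<Sum>w\<in>W. 2 * tau w)"
    using 1 sum.subset_diff[OF WVb fin(1), of "\<lambda>w. 2 * tau w"] by linarith

  let ?W = "\<lambda>i. {w \<in> W. lam w = i}"
  have "(\<Sum>w\<in>W. 2 * tau w) + 2 * card \<Lambda> = (\<Sum>i\<in>\<Lambda>. (\<Sum>w\<in>?W i. 2 * tau w) + 2)"
    using fin sum.group[of W \<Lambda> lam "\<lambda>w. 2 * tau w"]
      sum.distrib[of "\<lambda>i. \<Sum>w\<in>?W i. 2 * tau w" "\<lambda>_. 2" \<Lambda>]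
    by (simp add: \<Lambda>_def)
  also have "\<dots> \<le> (\<Sum>i\<in>\<Lambda>. card (\<Union>w\<in>?W i. Z w))"
    unfolding Z_def using WVb VbV
    by (intro sum_mono sum_tau_le_card_Union) (auto simp: \<Lambda>_def)
  also have "\<dots> = card (\<Union>i\<in>\<Lambda>. \<Union>w\<in>?W i. Z w)"
  proof (rule card_UN_disjoint[symmetric])
    show "finite \<Lambda>" using fin by (simp add: \<Lambda>_def)
    show "\<forall>i\<in>\<Lambda>. finite (\<Union>w\<in>?W i. Z w)" using fin finite_bag by (simp add: Z_def)
    have "(\<Union>w\<in>?W i. Z w) \<subseteq> X i" for i
    proof
      fix x assume "x \<in> (\<Union>w\<in>?W i. Z w)"
      then obtain w where w: "w \<in> W" "lam w = i" "x \<in> Z w" by blast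
      then have "x \<in> N w" using Z_N WVb VbV by blast
      then show "x \<in> X i" using N_W[OF w(1)] w(2) by blast
    qed
    then show "\<forall>i\<in>\<Lambda>. \<forall>j\<in>\<Lambda>. i \<noteq> j \<longrightarrow> (\<Union>w\<in>?W i. Z w) \<inter> (\<Union>w\<in>?W j. Z w) = {}"
      using X_disj by (meson disjoint_iff subset_iff)
  qed
  also have "(\<Union>i\<in>\<Lambda>. \<Union>w\<in>?W i. Z w) = (\<Union>w\<in>W. Z w)"
    by (auto simp: \<Lambda>_def)
  finally have 3: "(\<Sum>w\<in>W. 2 * tau w) + 2 * card \<Lambda> \<le> card (\<Union>w\<in>W. Z w)" .
  define F where "F = Vb - (\<Union>w\<in>W. Z w)"
  have "(\<Union>w\<in>W. Z w) \<subseteq> Vb" using Z_Vb WVb by blast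
  then have "card Vb = card F + card (\<Union>w\<in>W. Z w)"
    unfolding F_def using fin(1) by (metis card_Diff_subset card_mono finite_subset le_add_diff_inverse2)
  then have 4: "card F + 2 * card \<Lambda> \<le> 2 * card S" using 2 3 by linarith

  let ?L = "l ` Q"
  let ?R = "\<lambda>i. {v \<in> Va. l (Inl (rt v)) = i}"
  let ?D = "\<lambda>i. \<Union>(N ` ?R i) - ?R i"
  have AQ: "Inl r \<in> Q" if "r \<in> A" for r
    using that by (auto simp: A_def Q_def tokens_def)
  have N_Va: "N v \<subseteq> X (l (Inl (rt v)))" if "v \<in> Va" for v
  proof -
    have "N v \<subseteq> territory (Inl (rt v))" using that by (auto simp: Va_def)
    moreover have "Inl (rt v) \<in> Q" using that AQ by (simp add: Va_def)
    ultimately show ?thesis unfolding X_def by blast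
  qed
  have N_R: "\<Union>(N ` ?R i) \<subseteq> X i" for i using N_Va by blast
  have D: "2 \<le> card (?D i)" "?D i \<subseteq> F" if i: "i \<in> ?L - \<Lambda>" for i
  proof -
    obtain t where t: "t \<in> Q" "l t = i" using i by blast
    have "\<exists>r\<in>A. l (Inl r) = i"
    proof (cases t)
      case (Inl r)
      then show ?thesis using t by (auto simp: Q_def tokens_def A_def)
    next
      case (Inr p)
      obtain w j where p: "p = (w, j)" by force
      have w: "w \<in> V" "j < tau w" "Inr (w, j) \<notin> S" using t Inr p by (auto simp: Q_def tokens_def)
      have "w \<in> Va"
      proof (rule ccontr)
        assume "w \<notin> Va"
        then have wVb: "w \<in> Vb" using w by (simp add: Vb_def)
        then have wW: "w \<in> W" using in_S w by blast
        have "Inr (w, 0) \<in> tokens" using w by (auto simp: tokens_def)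
        then have "lam w = i"
          using absorb[of "Inr (w, 0)" t] t Inr p NV[OF w(1)] by (simp add: lam_def)
        then show False using wW i by (auto simp: \<Lambda>_def)
      qed
      then have "rt w \<in> A" "N w \<subseteq> territory (Inl (rt w))" by (auto simp: Va_def)
      moreover have "t \<in> tokens" "territory t = N w" using t Inr p by (simp_all add: Q_def)
      ultimately have "l t = l (Inl (rt w))"
        using absorb[of t "Inl (rt w)"] AQ NV[OF w(1)] by simp
      then show ?thesis using \<open>rt w \<in> A\<close> t by auto
    qed
    then obtain r where r: "r \<in> A" "l (Inl r) = i" by blast
    then have "r \<in> ?R i" using roots_eq by (auto simp: Va_def A_def roots_def)
    then have R: "?R i \<noteq> {}" "?R i \<subseteq> V" by (auto simp: Va_def)
    have "2 \<le> card ?L" using le by (simp add: Q_def)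
    then have "\<not> ?L \<subseteq> {i}" using card_mono[of "{i}" ?L] by auto
    then obtain u where u: "u \<in> Q" "l u \<noteq> i" by blast
    have uT: "u \<in> tokens" using u by (simp add: Q_def)
    have "territory u \<noteq> {} \<and> territory u \<subseteq> V"
    proof (cases u)
      case (Inl r)
      then have r: "r \<in> V" "rt r = r" using uT rt_root by (auto simp: tokens_def roots_def)
      then have "r \<in> territory u" using N_refl Inl by auto
      moreover have "territory u \<subseteq> V"
        unfolding Inl territory_simps by (intro UN_least N_subset) simp
      ultimately show ?thesis by blast
    next
      case (Inr p)
      then obtain w j where "u = Inr (w, j)" "w \<in> V" using uT by (auto simp: tokens_def)
      then show ?thesis using NV N_subset by simp
    qed
    then obtain x where x: "x \<in> territory u" "x \<in> V" by blast
    then have "x \<in> X (l u)" using u unfolding X_def by blast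
    then have "x \<notin> \<Union>(N ` ?R i)" using X_disj N_R u by blast
    then have "\<Union>(N ` ?R i) \<noteq> V" using x by blast
    with R show "2 \<le> card (?D i)" by (intro two)
    show "?D i \<subseteq> F"
    proof
      fix y assume y: "y \<in> ?D i"
      then have yV: "y \<in> V" and yX: "y \<in> X i" using N_subset R(2) N_R by blast+
      have "y \<notin> Va"
      proof
        assume "y \<in> Va"
        then have "y \<in> X (l (Inl (rt y)))" using N_Va N_refl[OF yV] by blast
        then have "l (Inl (rt y)) = i" using X_disj yX by blast
        then show False using y \<open>y \<in> Va\<close> by blast
      qed
      moreover have "y \<notin> Z w" if "w \<in> W" for w
      proof
        assume "y \<in> Z w"
        then have "y \<in> X (lam w)" using that Z_N N_W WVb VbV by blast
        then have "lam w = i" using X_disj yX by blast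
        then show False using that i by (auto simp: \<Lambda>_def)
      qed
      ultimately show "y \<in> F" using yV by (simp add: F_def Vb_def)
    qed
  qed
  have finF: "finite F" using fin by (simp add: F_def)
  have "2 * card (?L - \<Lambda>) = (\<Sum>i\<in>?L - \<Lambda>. 2)" by simp
  also have "\<dots> \<le> (\<Sum>i\<in>?L - \<Lambda>. card (?D i))" using D(1) by (rule sum_mono)
  also have "\<dots> = card (\<Union>i\<in>?L - \<Lambda>. ?D i)"
  proof (rule card_UN_disjoint[symmetric])
    show "finite (?L - \<Lambda>)" using finQ by simp
    show "\<forall>i\<in>?L - \<Lambda>. finite (?D i)" using finite_subset[OF D(2) finF] by blast
    show "\<forall>i\<in>?L - \<Lambda>. \<forall>j\<in>?L - \<Lambda>. i \<noteq> j \<longrightarrow> ?D i \<inter> ?D j = {}"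
    proof (intro ballI impI equals0I)
      fix i j x assume "i \<noteq> j" "x \<in> ?D i \<inter> ?D j"
      then have "x \<in> X i" "x \<in> X j" using N_R by blast+
      then show False using X_disj \<open>i \<noteq> j\<close> by blast
    qed
  qed
  also have "\<dots> \<le> card F" using D(2) by (intro card_mono[OF finF]) blast
  finally have 5: "2 * card (?L - \<Lambda>) \<le> card F" .
  have "finite \<Lambda>" using fin by (simp add: \<Lambda>_def)
  then have "card ?L \<le> card (?L - \<Lambda>) + card \<Lambda>"
    using finQ card_mono[of "(?L - \<Lambda>) \<union> \<Lambda>" ?L] card_Un_le[of "?L - \<Lambda>" \<Lambda>] by fastforce
  then show False using 4 5 le by (simp add: Q_def)
qed

end

lemma ex_map_card_fibres_2:
  assumes "finite B" "finite K" "card B = 2 * card K"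
  shows "\<exists>h. (\<forall>x\<in>B. h x \<in> K) \<and> (\<forall>k\<in>K. card {x \<in> B. h x = k} = 2)"
proof -
  have "card B = card (K \<times> (UNIV :: bool set))"
    using assms by (simp add: card_cartesian_product)
  then obtain g where g: "bij_betw g B (K \<times> (UNIV :: bool set))"
    using finite_same_card_bij[of B "K \<times> (UNIV :: bool set)"] assms by auto
  have "card {x \<in> B. fst (g x) = k} = 2" if k: "k \<in> K" for k
  proof -
    have "bij_betw g {x \<in> B. fst (g x) = k} ({k} \<times> (UNIV :: bool set))"
      unfolding bij_betw_def
    proof
      show "inj_on g {x \<in> B. fst (g x) = k}"
        using g by (auto simp: bij_betw_def intro: inj_on_subset)
      show "g ` {x \<in> B. fst (g x) = k} = {k} \<times> UNIV"
      proof (intro equalityI subsetI)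
        fix p assume "p \<in> {k} \<times> (UNIV :: bool set)"
        then have "p \<in> g ` B" "fst p = k" using g k by (auto simp: bij_betw_def)
        then show "p \<in> g ` {x \<in> B. fst (g x) = k}" by auto
      qed (auto simp: mem_Times_iff)
    qed
    then have "card {x \<in> B. fst (g x) = k} = card ({k} \<times> (UNIV :: bool set))"
      by (rule bij_betw_same_card)
    then show ?thesis by (simp add: card_cartesian_product)
  qed
  moreover have "fst (g x) \<in> K" if "x \<in> B" for x
    using bij_betwE[OF g] that by (metis mem_Times_iff)
  ultimately show ?thesis by (intro exI[of _ "\<lambda>x. fst (g x)"]) simp
qed

context evenly_oriented
begin

lemma quadruples_of_matching:
  assumes M: "matching tokens meets M" and cover: "\<Union>M = tokens"
  shows "\<exists>q :: 'a \<Rightarrow> ('a + 'a \<times> nat) set. \<forall>v\<in>V. card {u \<in> V. q u = q v} = 4 \<and>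
    (\<forall>u\<in>V. q u = q v \<longrightarrow>
      (\<exists>x\<in>V. \<exists>w\<in>V. \<exists>w'\<in>V. u \<in> N w \<and> x \<in> N w \<and> x \<in> N w' \<and> v \<in> N w'))"
proof -
  have "\<forall>s\<in>tokens. \<exists>e. e \<in> M \<and> s \<in> e" using cover by blast
  from bchoice[OF this] obtain E where "\<forall>s\<in>tokens. E s \<in> M \<and> s \<in> E s" by (elim exE)
  note E = this[rule_format]
  have E_eq: "E s = e" if "e \<in> M" "s \<in> e" for s e
  proof -
    have "s \<in> tokens" using that cover by blast
    then show ?thesis using matching_disjoint[OF M, of "E s" e] E that by blast
  qed
  have territory_V: "territory s \<subseteq> V" if "s \<in> tokens" for s
    using that
  proof (cases s)
    case (Inl r)
    show ?thesis unfolding Inl territory_simps by (intro UN_least N_subset) simp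
  next
    case (Inr p)
    then obtain w j where "s = Inr (w, j)" "w \<in> V" using \<open>s \<in> tokens\<close> by (auto simp: tokens_def)
    then show ?thesis using N_subset by simp
  qed
  have "\<forall>e\<in>M. \<exists>x. x \<in> V \<and> (\<forall>s\<in>e. x \<in> territory s)"
  proof
    fix e assume "e \<in> M"
    then obtain s t where st: "e = {s, t}" "s \<in> tokens" "meets s t"
      using M by (auto simp: matching_def)
    then obtain x where "x \<in> territory s" "x \<in> territory t" by (auto simp: meets_def)
    then show "\<exists>x. x \<in> V \<and> (\<forall>s\<in>e. x \<in> territory s)"
      using st territory_V by (intro exI[of _ x]) auto
  qed
  from bchoice[OF this] obtain pnt
    where pnt0: "\<forall>e\<in>M. pnt e \<in> V \<and> (\<forall>s\<in>e. pnt e \<in> territory s)" by (elim exE)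
  have pnt: "\<And>e. e \<in> M \<Longrightarrow> pnt e \<in> V" "\<And>e s. e \<in> M \<Longrightarrow> s \<in> e \<Longrightarrow> pnt e \<in> territory s"
    using pnt0 by simp_all
  have "\<forall>r\<in>roots. \<exists>y. y \<in> V \<and> rt y = r \<and> pnt (E (Inl r)) \<in> N y"
  proof
    fix r assume "r \<in> roots"
    then have "Inl r \<in> tokens" by (simp add: tokens_def)
    then have "pnt (E (Inl r)) \<in> territory (Inl r)" using E pnt by blast
    then show "\<exists>y. y \<in> V \<and> rt y = r \<and> pnt (E (Inl r)) \<in> N y" by auto
  qed
  from bchoice[OF this] obtain f
    where "\<forall>r\<in>roots. f r \<in> V \<and> rt (f r) = r \<and> pnt (E (Inl r)) \<in> N (f r)" by (elim exE)
  note f = this[rule_format]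
  obtain c where c: "\<forall>v\<in>V. c v \<in> N v"
    "\<forall>w\<in>V. card {v \<in> V. c v = w} = 2 * tau w + (if f (rt w) = w then 2 else 0)"
    using reroot_all[of f] f by (auto simp: roots_def)
  define place where "place = case_sum f (fst :: 'a \<times> nat \<Rightarrow> 'a)"
  define T where "T w = {s \<in> tokens. place s = w}" for w
  have place: "place s \<in> V" "pnt (E s) \<in> N (place s)" if "s \<in> tokens" for s
  proof -
    have "pnt (E s) \<in> territory s" using E[OF that] pnt by blast
    then show "place s \<in> V" "pnt (E s) \<in> N (place s)"
      using that f by (auto simp: tokens_def place_def)
  qed
  have card_T: "card {v \<in> V. c v = w} = 2 * card (T w)" if w: "w \<in> V" for w
  proof -
    have "T w = (if f (rt w) = w then {Inl (rt w)} else {}) \<union> Inr ` ({w} \<times> {..<tau w})"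
      using f w rt_V b_rt
      by (auto simp: T_def place_def tokens_def roots_def)
    then have "card (T w) = (if f (rt w) = w then 1 else 0) + tau w"
      by (simp add: card_image card_cartesian_product image_iff card_insert_if)
    then show ?thesis using c(2) w by simp
  qed
  have "\<forall>w\<in>V. \<exists>h. (\<forall>v\<in>{v \<in> V. c v = w}. h v \<in> T w) \<and>
    (\<forall>s\<in>T w. card {v \<in> {v \<in> V. c v = w}. h v = s} = 2)"
    by (intro ballI ex_map_card_fibres_2 card_T) (simp_all add: T_def finite_V finite_tokens)
  from bchoice[OF this] obtain h0 where
    h00: "\<forall>w\<in>V. (\<forall>v\<in>{v \<in> V. c v = w}. h0 w v \<in> T w) \<and>
      (\<forall>s\<in>T w. card {v \<in> {v \<in> V. c v = w}. h0 w v = s} = 2)" by (elim exE)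
  have h0: "\<And>w v. w \<in> V \<Longrightarrow> v \<in> V \<Longrightarrow> c v = w \<Longrightarrow> h0 w v \<in> T w"
    "\<And>w s. w \<in> V \<Longrightarrow> s \<in> T w \<Longrightarrow> card {v \<in> {v \<in> V. c v = w}. h0 w v = s} = 2"
    using h00 by simp_all
  define h where "h v = h0 (c v) v" for v
  have cV: "c v \<in> V" if "v \<in> V" for v using c(1) N_subset that by blast
  have h: "h v \<in> tokens" "place (h v) = c v" if "v \<in> V" for v
    using h0(1)[OF cV[OF that] that refl] by (simp_all add: h_def T_def)
  have card_h: "card {v \<in> V. h v = s} = 2" if s: "s \<in> tokens" for s
  proof -
    have "{v \<in> V. h v = s} = {v \<in> {v \<in> V. c v = place s}. h0 (place s) v = s}"
      using h by (auto simp: h_def)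
    moreover have "s \<in> T (place s)" using s by (simp add: T_def)
    ultimately show ?thesis using h0(2)[OF place(1)[OF s]] by simp
  qed
  show ?thesis
  proof (intro exI[of _ "\<lambda>v. E (h v)"] ballI conjI impI)
    fix v assume v: "v \<in> V"
    let ?e = "E (h v)"
    have e: "?e \<in> M" using E h(1)[OF v] by blast
    then obtain s t where st: "?e = {s, t}" "s \<noteq> t" "s \<in> tokens" "t \<in> tokens"
      using M by (auto simp: matching_def)
    have "{u \<in> V. E (h u) = ?e} = {u \<in> V. h u = s} \<union> {u \<in> V. h u = t}"
      using E_eq[OF e] E h(1) st by blast
    moreover have "card ({u \<in> V. h u = s} \<union> {u \<in> V. h u = t}) = 4"
      using finite_V st card_h by (subst card_Un_disjoint) auto
    ultimately show "card {u \<in> V. E (h u) = ?e} = 4" by simp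
    fix u assume u: "u \<in> V" "E (h u) = ?e"
    have near: "y \<in> N (c y) \<and> pnt (E (h y)) \<in> N (c y)" if "y \<in> V" for y
      using place(2)[OF h(1)[OF that]] h(2)[OF that] c(1) that N_sym by auto
    show "\<exists>x\<in>V. \<exists>w\<in>V. \<exists>w'\<in>V. u \<in> N w \<and> x \<in> N w \<and> x \<in> N w' \<and> v \<in> N w'"
      using near[OF u(1)] near[OF v] u cV[OF u(1)] cV[OF v] pnt(1)[OF e] by metis
  qed
qed

end

theorem (in closed_neighbourhoods) ex_quadruples:
  assumes "4 dvd card V"
    and two: "\<forall>R\<subseteq>V. R \<noteq> {} \<longrightarrow> \<Union>(N ` R) \<noteq> V \<longrightarrow> 2 \<le> card (\<Union>(N ` R) - R)"
  shows "\<exists>q :: 'a \<Rightarrow> ('a + 'a \<times> nat) set. \<forall>v\<in>V. card {u \<in> V. q u = q v} = 4 \<and>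
    (\<forall>u\<in>V. q u = q v \<longrightarrow>
      (\<exists>x\<in>V. \<exists>w\<in>V. \<exists>w'\<in>V. u \<in> N w \<and> x \<in> N w \<and> x \<in> N w' \<and> v \<in> N w'))"
proof -
  have "even (card V)" using dvd_trans[OF _ assms(1), of 2] by simp
  from ex_even_orientation[OF this] obtain b rk rt
    where "even_orientation V (\<lambda>_. 0) b rk rt" by (elim exE)
  then interpret evenly_oriented V N b rk rt by unfold_locales
  obtain k where "card V = 4 * k" using assms(1) by (elim dvdE)
  then have "card tokens = 2 * k" using card_tokens by simp
  then have "even (card tokens)" by simp
  from finite_tokens this symp_meets show ?thesis
  proof (cases rule: perfect_matching_or_barrier)
    case (matching M)
    then show ?thesis by (rule quadruples_of_matching)
  next
    case (barrier S l)
    from no_barrier[OF two[rule_format] barrier] show ?thesis ..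
  qed
qed

section \<open>Factors of graph powers\<close>

lemma connected_induced_arc:
  fixes G :: "'a pair_pre_digraph"
  assumes "connected (with_proj G \<restriction> W)" "sym (parcs G)" "U \<subseteq> W" "U \<noteq> {}" "U \<noteq> W"
  shows "\<exists>u\<in>U. \<exists>v\<in>W - U. (u, v) \<in> parcs G"
proof -
  let ?r = "parcs (mk_symmetric (with_proj G \<restriction> W))"
  have r: "(x, y) \<in> parcs G" "y \<in> W" if "(x, y) \<in> ?r" for x y
    using that symD[OF assms(2)] by (auto simp: mk_symmetric_def)
  obtain u v where u: "u \<in> U" and v: "v \<in> W" "v \<notin> U" using assms(3-5) by blast
  have "u \<rightarrow>\<^sup>*\<^bsub>with_proj (mk_symmetric (with_proj G \<restriction> W))\<^esub> v"
    using assms(1,3) u v by (auto simp: connected_def strongly_connected_def mk_symmetric_def)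
  then have "(u, v) \<in> ?r\<^sup>*"
    unfolding reachable_def by (auto dest: rtrancl_on_rtranclI)
  then have "v \<in> U \<or> (\<exists>u\<in>U. \<exists>v\<in>W - U. (u, v) \<in> parcs G)"
  proof (induction rule: rtrancl_induct)
    case (step y z)
    then show ?case using r[OF step(2)] by blast
  qed (use u in simp)
  then show ?thesis using v by simp
qed

lemma (in wf_digraph) ex_apath_length_le:
  assumes "awalk u p v"
  shows "\<exists>q. apath u q v \<and> length q \<le> length p"
  using assms
proof (induct rule: awalk_to_apath_induct)
  case (path p)
  then show ?case by (auto simp: apath_def)
next
  case (decomp p q r s)
  then have "p = q @ r @ s" using awalk_cyc_decomp_has_prop[of u p v] by auto
  then show ?case using decomp by auto
qed

lemma complete_factor_of_classes:
  fixes G :: "'a pair_pre_digraph"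
  assumes G: "pair_graph G"
    and card: "\<And>v. v \<in> pverts G \<Longrightarrow> card {u \<in> pverts G. q u = q v} = r"
    and arcs: "\<And>u v. u \<in> pverts G \<Longrightarrow> v \<in> pverts G \<Longrightarrow> u \<noteq> v \<Longrightarrow> q u = q v \<Longrightarrow> (u, v) \<in> parcs G"
  shows "\<exists>H. complete_factor r H G"
proof -
  interpret G: pair_graph G by fact
  define H where "H = \<lparr> pverts = pverts G,
    parcs = {(u, v). u \<in> pverts G \<and> v \<in> pverts G \<and> u \<noteq> v \<and> q u = q v} \<rparr>"
  have "finite (parcs H)"
    by (rule finite_subset[of _ "pverts G \<times> pverts G"]) (auto simp: H_def)
  then interpret H: pair_graph H
    by unfold_locales (auto simp: H_def symmetric_def sym_def)
  have "spanning (with_proj H) (with_proj G)"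
    unfolding spanning_def subgraph_def
    using arcs G.wf_digraph H.wf_digraph by (auto simp: H_def)
  moreover have "K\<^bsub>r\<^esub> C" if C: "C \<in> H.sccs" for C
  proof -
    have ind: "induced_subgraph C (with_proj H)" and sc: "strongly_connected C"
      and max: "\<And>D. induced_subgraph D (with_proj H) \<Longrightarrow> strongly_connected D \<Longrightarrow> \<not> verts C \<subset> verts D"
      using C by (auto simp: H.sccs_def)
    obtain v where v: "v \<in> verts C" using sc by (auto simp: strongly_connected_def)
    then have vG: "v \<in> pverts G" using ind by (auto simp: induced_subgraph_def subgraph_def H_def)
    let ?Q = "{u \<in> pverts G. q u = q v}"
    let ?D = "with_proj H \<restriction> ?Q"
    have reach: "q x = q y" if "x \<rightarrow>\<^sup>*\<^bsub>with_proj H\<^esub> y" for x y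
      using that by (induct rule: H.reachable_induct) (auto simp: H_def)
    have "verts C \<subseteq> ?Q"
    proof
      fix u assume u: "u \<in> verts C"
      have "u \<rightarrow>\<^sup>*\<^bsub>C\<^esub> v" using sc u v by (simp add: strongly_connected_def)
      then have "u \<rightarrow>\<^sup>*\<^bsub>with_proj H\<^esub> v"
        by (rule H.reachable_mono) (use ind in \<open>simp add: induced_subgraph_def\<close>)
      then have "q u = q v" by (rule reach)
      moreover have "u \<in> pverts G"
        using u ind by (auto simp: induced_subgraph_def subgraph_def H_def)
      ultimately show "u \<in> ?Q" by simp
    qed
    moreover have "induced_subgraph ?D (with_proj H)"
      by (rule H.induced_induce) (auto simp: H_def)
    moreover have "strongly_connected ?D"
    proof
      show "verts ?D \<noteq> {}" using vG by auto
      fix x y assume xy: "x \<in> verts ?D" "y \<in> verts ?D"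
      show "x \<rightarrow>\<^sup>*\<^bsub>?D\<^esub> y"
      proof (cases "x = y")
        case True
        then show ?thesis using xy by (auto simp: reachable_def)
      next
        case False
        then have "(x, y) \<in> arcs_ends ?D" using xy by (auto simp: H_def arcs_ends_conv)
        then show ?thesis
          unfolding reachable_def
          using rtrancl_on_into_rtrancl_on[OF rtrancl_on_refl[OF xy(1)] _ xy(2)] by blast
      qed
    qed
    ultimately have "verts C = ?Q" using max[of ?D] by auto
    have "arcs C = {e \<in> parcs H. fst e \<in> ?Q \<and> snd e \<in> ?Q}"
      using ind unfolding induced_subgraph_def \<open>verts C = ?Q\<close> by simp
    also have "\<dots> = {(x, y). x \<in> ?Q \<and> y \<in> ?Q \<and> x \<noteq> y}"
      unfolding H_def by force
    finally have "arcs C = {(x, y). x \<in> ?Q \<and> y \<in> ?Q \<and> x \<noteq> y}" .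
    moreover have "tail C = fst" "head C = snd"
      using ind by (auto simp: induced_subgraph_def subgraph_def compatible_def)
    ultimately have C_eq: "C = with_proj \<lparr> pverts = ?Q, parcs = {(x, y). x \<in> ?Q \<and> y \<in> ?Q \<and> x \<noteq> y} \<rparr>"
      using \<open>verts C = ?Q\<close> by (simp add: with_proj_def)
    show ?thesis unfolding C_eq complete_digraph_pair_def
      using card[OF vG] G.finite_verts by auto
  qed
  ultimately show ?thesis using H.pair_graph_axioms unfolding complete_factor_def by blast
qed

theorem mainTheorem3:
  fixes G :: "'a pair_pre_digraph"
  assumes "pair_graph G"
    and "k_connected 2 (with_proj G)"
    and "4 dvd card (pverts G)"
  shows "\<exists>H. complete_factor 4 H (graph_power G 4)"
proof -
  interpret pair_graph G by fact
  let ?V = "pverts G"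
  define N where "N x = {y \<in> ?V. y = x \<or> (x, y) \<in> parcs G}" for x
  have conn: "connected (with_proj G \<restriction> (?V - X))" if "X \<subseteq> ?V" "card X < 2" for X
    using assms(2) that by (simp add: k_connected_def)
  have card_V: "2 < card ?V" using assms(2) by (simp add: k_connected_def)
  have sym: "sym (parcs G)" using sym_arcs by (simp add: symmetric_def)
  have cut: "\<exists>u\<in>U. \<exists>v\<in>?V - X - U. (u, v) \<in> parcs G"
    if "X \<subseteq> ?V" "card X < 2" "U \<subseteq> ?V - X" "U \<noteq> {}" "U \<noteq> ?V - X" for X U
    using connected_induced_arc[OF conn[OF that(1,2)] sym that(3-5)] .
  interpret N: closed_neighbourhoods ?V N
  proof
    show "finite ?V" by simp
    show "?V \<noteq> {}" using card_V by auto
    show "N x \<subseteq> ?V" for x by (auto simp: N_def)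
    show "x \<in> N x" if "x \<in> ?V" for x using that by (simp add: N_def)
    show "x \<in> N y" if "x \<in> ?V" "y \<in> N x" for x y using that symD[OF sym] by (auto simp: N_def)
    show "\<exists>u\<in>U. \<exists>v\<in>?V - U. v \<in> N u" if "U \<subseteq> ?V" "U \<noteq> {}" "U \<noteq> ?V" for U
      using cut[of "{}" U] that by (auto simp: N_def)
  qed
  have two: "\<forall>R\<subseteq>?V. R \<noteq> {} \<longrightarrow> \<Union>(N ` R) \<noteq> ?V \<longrightarrow> 2 \<le> card (\<Union>(N ` R) - R)"
  proof (intro allI impI, rule ccontr)
    fix R assume R: "R \<subseteq> ?V" "R \<noteq> {}" "\<Union>(N ` R) \<noteq> ?V"
    let ?X = "\<Union>(N ` R) - R"
    assume "\<not> 2 \<le> card ?X"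
    moreover have "?X \<subseteq> ?V" by (auto simp: N_def)
    moreover have "R \<subseteq> \<Union>(N ` R)" using R(1) by (auto simp: N_def)
    moreover have "\<Union>(N ` R) \<subseteq> ?V" by (auto simp: N_def)
    ultimately have "\<exists>u\<in>R. \<exists>v\<in>?V - ?X - R. (u, v) \<in> parcs G"
      using R by (intro cut) auto
    then show False by (auto simp: N_def)
  qed
  obtain q :: "'a \<Rightarrow> ('a + 'a \<times> nat) set" where
    q: "\<forall>v\<in>?V. card {u \<in> ?V. q u = q v} = 4 \<and> (\<forall>u\<in>?V. q u = q v \<longrightarrow>
      (\<exists>x\<in>?V. \<exists>w\<in>?V. \<exists>w'\<in>?V. u \<in> N w \<and> x \<in> N w \<and> x \<in> N w' \<and> v \<in> N w'))"
    using N.ex_quadruples[OF assms(3) two] by (elim exE)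
  have step: "\<exists>p. awalk x p y \<and> length p \<le> 1" if "x \<in> ?V" "y \<in> N x" for x y
  proof (cases "y = x")
    case True
    then show ?thesis using that by (intro exI[of _ "[]"]) (simp add: awalk_Nil_iff)
  next
    case False
    then have "(x, y) \<in> parcs G" using that by (simp add: N_def)
    then show ?thesis using arc_implies_awalk[of "(x, y)"] by (intro exI[of _ "[(x, y)]"]) simp
  qed
  have "(u, v) \<in> parcs (graph_power G 4)" if uv: "u \<in> ?V" "v \<in> ?V" "u \<noteq> v" "q u = q v" for u v
  proof -
    from q uv obtain x w w' where "x \<in> ?V" "w \<in> ?V" "w' \<in> ?V"
      "u \<in> N w" "x \<in> N w" "x \<in> N w'" "v \<in> N w'" by blast
    then obtain p1 p2 p3 p4 where p: "awalk u p1 w" "awalk w p2 x" "awalk x p3 w'" "awalk w' p4 v"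
      and len: "length p1 \<le> 1" "length p2 \<le> 1" "length p3 \<le> 1" "length p4 \<le> 1"
      using step N.N_sym uv(1) by meson
    then have "awalk u (p1 @ p2 @ p3 @ p4) v" by (blast intro: awalk_appendI)
    from ex_apath_length_le[OF this] obtain p where "apath u p v" "length p \<le> length (p1 @ p2 @ p3 @ p4)"
      by blast
    then have "apath u p v" "length p \<le> 4" using len by auto
    then show ?thesis using uv by (auto simp: graph_power_def)
  qed
  then show ?thesis
    using q by (intro complete_factor_of_classes[of _ q] pair_graph_graph_power assms(1))
      (auto simp: graph_power_def)
qed

end
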